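(* Let $\Phi_n$ be a root system of type $A_{n-1}$ ($n\ge 2$), $B_n$ ($n\ge 2$) or $D_n$ ($n\ge 4$) in its standard form in a Euclidean space $V$ with orthonormal basis $\{x_1,\dots,x_n\}$, and let $\mathcal{B}$ be the Boolean system for $W(\Phi_n)$. Then the Boolean reflection monoid $M(\Phi_n,\mathcal{B})$ has order $$|M(\Phi_n,\mathcal{B})|=|W(\Phi_n)|\sum_{k=0}^n\binom{n}{k}\frac{1}{|W(\Phi_k)|},$$ where $\Phi_k$ denotes the root system of the same family ($A_{k-1}$, $B_k$ or $D_k$ respectively).
   Context: Standard root systems: type $A_{n-1}$: $\{x_i-x_j : 1\le i\ne j\le n\}$; type $B_n$: $\{\pm x_i : 1\le i\le n\}\cup\{\pm x_i\pm x_j : 1\le i<j\le n\}$; type $D_n$: $\{\pm x_i\pm x_j : 1\le i<j\le n\}$. Conventions for small indices: $A_{-1}=A_0=\varnothing$, $B_0=\varnothing$, $B_1=\{\pm x_1\}$, $D_0=D_1=\varnothing$, and $D_k=\{\pm x_i\pm x_j : 1\le i<j\le k\}$ for $k=2,3$. The Weyl group $W(\Phi)$ is the group of linear maps of $V$ generated by the orthogonal reflections $s_v$ in the hyperplanes $v^\perp$, $v\in\Phi$ (trivial if $\Phi=\varnothing$). Maps are written on the right. For a group $W\subset GL(V)$, a system of subspaces for $W$ is a collection of subspaces of $V$ that contains $V$, is closed under the action $X\mapsto Xg$ of all $g\in W$, and is closed under pairwise intersection; the system generated by a set of subspaces is the smallest system for $W$ containing it. The Boolean system $\mathcal{B}$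 for $W(\Phi_n)$ is the system for $W(\Phi_n)$ generated by the coordinate hyperplanes $x_1^\perp,\dots,x_n^\perp$. $M(\Phi_n,\mathcal{B})=\{g_X \mid g\in W(\Phi_n),\ X\in\mathcal{B}\}$, where $g_X:X\to Xg$ is the restriction of $g$ to $X$; it is a monoid under composition of partial maps. *)

theory Defs
  imports "HOL-Analysis.Analysis" "HOL-Algebra.Generated_Groups"
begin

text \<open>Maps are written on the right, so the product of \<open>f\<close> and \<open>g\<close> is ``first \<open>f\<close>, then \<open>g\<close>''.\<close>

definition GL :: "('a::real_vector \<Rightarrow> 'a) monoid" where
  "GL = \<lparr>carrier = {f. linear f \<and> bij f}, mult = (\<lambda>f g. g \<circ> f), one = id\<rparr>"

definition reflection :: "'a::real_inner \<Rightarrow> 'a \<Rightarrow> 'a" where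
  "reflection v u = u - (2 * (u \<bullet> v) / (v \<bullet> v)) *\<^sub>R v"

definition weyl_group :: "'a::real_inner set \<Rightarrow> ('a \<Rightarrow> 'a) monoid" where
  "weyl_group \<Phi> = subgroup_generated GL (reflection ` \<Phi>)"

text \<open>
  The library's \<^const>\<open>subgroup_generated\<close> discards generators outside the carrier; by
  \<open>reflection_in_GL\<close> below no reflection is lost.
\<close>

lemma group_GL: "group GL"
proof (rule groupI)
  fix f :: "'a \<Rightarrow> 'a" assume f: "f \<in> carrier GL"
  then have "bij f" "linear f" by (auto simp: GL_def)
  then have "linear (inv_into UNIV f)"
    by (intro linearI; simp add: bij_is_inj inv_f_eq linear_add linear_scale bij_is_surj surj_f_inv_f)
  moreover have "bij (inv_into UNIV f)" "inv_into UNIV f \<circ> f = id" "f \<circ> inv_into UNIV f = id"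
    using \<open>bij f\<close> by (simp_all add: bij_imp_bij_inv bij_is_inj bij_is_surj surj_iff[symmetric])
  ultimately show "\<exists>g\<in>carrier GL. g \<otimes>\<^bsub>GL\<^esub> f = \<one>\<^bsub>GL\<^esub>"
    by (intro bexI[of _ "inv_into UNIV f"]) (simp_all add: GL_def)
qed (auto simp: GL_def linear_compose bij_comp o_assoc module_hom_id linear_id)

lemma reflection_in_GL: "reflection v \<in> carrier GL"
proof -
  have "linear (reflection v)"
    by (intro linearI)
      (auto simp: reflection_def algebra_simps add_divide_distrib)
  moreover have "reflection v (reflection v u) = u" for u
    by (cases "v = 0") (auto simp: reflection_def algebra_simps inner_diff_left)
  then have "bij (reflection v)"
    by (rule involuntory_imp_bij)
  ultimately show ?thesis by (simp add: GL_def)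
qed

lemma group_weyl_group: "group (weyl_group \<Phi>)"
  unfolding weyl_group_def by (rule group.group_subgroup_generated[OF group_GL])

datatype root_family = Type_A | Type_B | Type_D

text \<open>
  The index of \<open>standard_roots F x k\<close> is the number of coordinates used: \<open>Type_A\<close> at index \<open>k\<close>
  is the root system \<open>A\<close> of rank \<open>k - 1\<close>. The conventions for small indices
  (empty for \<open>k = 0\<close>, and for \<open>k = 1\<close> empty in types \<open>A\<close> and \<open>D\<close> and \<open>{x 1, - x 1}\<close> in type \<open>B\<close>)
  are instances of the general formulas.
\<close>

fun standard_roots :: "root_family \<Rightarrow> (nat \<Rightarrow> 'a::real_vector) \<Rightarrow> nat \<Rightarrow> 'a set" where
  "standard_roots Type_A x k = {x i - x j | i j. i \<in> {1..k} \<and> j \<in> {1..k} \<and> i \<noteq> j}"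
| "standard_roots Type_B x k =
     {s *\<^sub>R x i | s i. s \<in> {1, -1} \<and> i \<in> {1..k}} \<union>
     {s *\<^sub>R x i + t *\<^sub>R x j | s t i j. s \<in> {1, -1} \<and> t \<in> {1, -1} \<and> 1 \<le> i \<and> i < j \<and> j \<le> k}"
| "standard_roots Type_D x k =
     {s *\<^sub>R x i + t *\<^sub>R x j | s t i j. s \<in> {1, -1} \<and> t \<in> {1, -1} \<and> 1 \<le> i \<and> i < j \<and> j \<le> k}"

definition subspace_system :: "('a::real_vector \<Rightarrow> 'a, 'b) monoid_scheme \<Rightarrow> 'a set set \<Rightarrow> bool" where
  "subspace_system W S \<longleftrightarrow>
     (\<forall>X\<in>S. subspace X) \<and>
     UNIV \<in> S \<and>
     (\<forall>X\<in>S. \<forall>g\<in>carrier W. g ` X \<in> S) \<and>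
     (\<forall>X\<in>S. \<forall>Y\<in>S. X \<inter> Y \<in> S)"

definition boolean_system ::
    "('a::real_inner \<Rightarrow> 'a, 'b) monoid_scheme \<Rightarrow> (nat \<Rightarrow> 'a) \<Rightarrow> nat \<Rightarrow> 'a set set" where
  "boolean_system W x n = subspace_system W hull ((\<lambda>i. {u. u \<bullet> x i = 0}) ` {1..n})"

text \<open>
  The map \<open>g\<^sub>X : X \<rightarrow> X g\<close> is encoded as a partial map on the whole space with domain \<open>X\<close>; its
  target is its range, so nothing is lost by not recording it.
\<close>

definition partial_restrict :: "('a \<Rightarrow> 'b) \<Rightarrow> 'a set \<Rightarrow> 'a \<rightharpoonup> 'b" where
  "partial_restrict g X = (\<lambda>u. Some (g u)) |` X"

definition reflection_monoid ::
    "('a \<Rightarrow> 'a, 'b) monoid_scheme \<Rightarrow> 'a set set \<Rightarrow> ('a \<rightharpoonup> 'a) monoid" where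
  "reflection_monoid W S =
     \<lparr>carrier = {partial_restrict g X | g X. g \<in> carrier W \<and> X \<in> S},
      mult = (\<lambda>f g. g \<circ>\<^sub>m f),
      one = Some\<rparr>"

lemma subspace_system_boolean_system:
  fixes x :: "nat \<Rightarrow> 'a::real_inner"
  assumes W: "carrier W \<subseteq> carrier GL"
  shows "subspace_system W (boolean_system W x n)"
proof -
  let ?H = "(\<lambda>i. {u. u \<bullet> x i = 0}) ` {1..n}"
  have "subspace {u. u \<bullet> x i = 0}" for i
    by (auto simp: subspace_def inner_add_left)
  moreover have "subspace_system W (Collect subspace)"
    using W by (auto simp: subspace_system_def GL_def subspace_inter intro: linear_subspace_image)
  ultimately have A: "Collect subspace \<in> {T. subspace_system W T \<and> ?H \<subseteq> T}" by auto
  define \<T> where "\<T> = {T. subspace_system W T \<and> ?H \<subseteq> T}"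
  have T: "subspace_system W T" if "T \<in> \<T>" for T
    using that by (simp add: \<T>_def)
  have "Collect subspace \<in> \<T>" using A by (simp only: \<T>_def)
  then have "\<forall>X\<in>\<Inter>\<T>. subspace X" by blast
  moreover have "UNIV \<in> \<Inter>\<T>"
    using T by (simp add: subspace_system_def)
  moreover have "\<forall>X\<in>\<Inter>\<T>. \<forall>g\<in>carrier W. g ` X \<in> \<Inter>\<T>"
    using T by (simp add: subspace_system_def)
  moreover have "\<forall>X\<in>\<Inter>\<T>. \<forall>Y\<in>\<Inter>\<T>. X \<inter> Y \<in> \<Inter>\<T>"
    using T by (simp add: subspace_system_def)
  ultimately have "subspace_system W (\<Inter>\<T>)"
    unfolding subspace_system_def by (intro conjI)
  then show ?thesis
    by (simp only: boolean_system_def hull_def \<T>_def)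
qed

lemma carrier_weyl_group: "carrier (weyl_group \<Phi>) \<subseteq> carrier GL"
  unfolding weyl_group_def by (rule group.carrier_subgroup_generated_subset[OF group_GL])

lemma monoid_reflection_monoid:
  assumes S: "subspace_system (weyl_group \<Phi>) S"
  shows "monoid (reflection_monoid (weyl_group \<Phi>) S)"
proof -
  interpret W: group "weyl_group \<Phi>" by (rule group_weyl_group)
  have mult: "f \<otimes>\<^bsub>weyl_group \<Phi>\<^esub> g = g \<circ> f" and one: "\<one>\<^bsub>weyl_group \<Phi>\<^esub> = id" for f g :: "'a \<Rightarrow> 'a"
    by (simp_all add: weyl_group_def subgroup_generated_def GL_def)
  have comp: "partial_restrict h Y \<circ>\<^sub>m partial_restrict g X \<in> carrier (reflection_monoid (weyl_group \<Phi>) S)"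
    if g: "g \<in> carrier (weyl_group \<Phi>)" and h: "h \<in> carrier (weyl_group \<Phi>)"
      and X: "X \<in> S" and Y: "Y \<in> S" for g h X Y
  proof -
    define k where "k = inv\<^bsub>weyl_group \<Phi>\<^esub> g"
    have k: "k \<in> carrier (weyl_group \<Phi>)" using g by (simp add: k_def)
    have "k \<circ> g = id" "g \<circ> k = id"
      using W.r_inv[OF g] W.l_inv[OF g] by (simp_all add: mult one k_def)
    then have kg: "k (g u) = u" "g (k u) = u" for u
      by (metis comp_apply id_apply)+
    have iff: "u \<in> k ` Y \<longleftrightarrow> g u \<in> Y" for u
      using kg by (metis imageE imageI)
    have "partial_restrict h Y \<circ>\<^sub>m partial_restrict g X = partial_restrict (h \<circ> g) (X \<inter> k ` Y)"
      by (rule ext) (auto simp: partial_restrict_def map_comp_def restrict_map_def iff)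
    moreover have "h \<circ> g \<in> carrier (weyl_group \<Phi>)"
      using W.m_closed[OF g h] by (simp add: mult)
    moreover have "X \<inter> k ` Y \<in> S"
      using S X Y k by (auto simp: subspace_system_def)
    ultimately show ?thesis
      by (auto simp: reflection_monoid_def)
  qed
  show ?thesis
  proof (rule monoidI)
    show "\<one>\<^bsub>reflection_monoid (weyl_group \<Phi>) S\<^esub> \<in> carrier (reflection_monoid (weyl_group \<Phi>) S)"
      using W.one_closed S unfolding one
      by (auto simp: reflection_monoid_def partial_restrict_def subspace_system_def
          intro!: exI[of _ id] exI[of _ UNIV])
  next
    fix f g assume "f \<in> carrier (reflection_monoid (weyl_group \<Phi>) S)"
      "g \<in> carrier (reflection_monoid (weyl_group \<Phi>) S)"
    then show "f \<otimes>\<^bsub>reflection_monoid (weyl_group \<Phi>) S\<^esub> g \<in> carrier (reflection_monoid (weyl_group \<Phi>) S)"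
      using comp by (auto simp: reflection_monoid_def)
  qed (auto simp: reflection_monoid_def map_comp_def fun_eq_iff split: option.split)
qed

end

theory Submission
  imports Defs
begin

text \<open>
  The members of the Boolean system are the coordinate subspaces
  \<open>X\<^sub>J = {u. \<forall>i\<in>J. u \<bullet> x i = 0}\<close> for \<open>J \<subseteq> {1..n}\<close> (\<open>boolean_system_eq\<close>): these are the
  intersections of coordinate hyperplanes, and the Weyl group permutes them, because it acts on the
  orthonormal frame by signed permutations. Different \<open>J\<close> give different subspaces, and a partial
  map determines its domain. The order of the monoid is therefore the sum, over all \<open>J\<close>, of the
  number of different restrictions to \<open>X\<^sub>J\<close> of elements of \<open>W\<close>. Two elements of \<open>W\<close> have the same
  restriction iff they lie in the same coset of the pointwise stabilizer of \<open>X\<^sub>J\<close>, so this number is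
  \<open>|W|\<close> divided by the order of that stabilizer (\<open>card_restrictions_times_fixer\<close>).

  It remains to see that the stabilizer of \<open>X\<^sub>J\<close> has the order of \<open>W(\<Phi>\<^sub>k)\<close>, where \<open>k = |J|\<close>. All
  three families of Weyl groups contain every permutation of the frame, so conjugation reduces the
  claim to \<open>J = {1..k}\<close> (\<open>card_fixer_coord_subspace\<close>). For this \<open>J\<close> the stabilizer even equals
  \<open>W(\<Phi>\<^sub>k)\<close>. This follows from an explicit description (\<open>carrier_weyl_group_standard\<close>): \<open>W(\<Phi>\<^sub>k)\<close>
  consists of the signed permutations of the whole frame that fix \<open>x i\<close> for every \<open>i > k\<close>, with no
  signs in type \<open>A\<close>, arbitrary signs in type \<open>B\<close>, and evenly many negative signs in type \<open>D\<close>. That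
  such maps are products of reflections is shown by induction on \<open>k\<close>, composing with reflections
  until the last vector of the frame is fixed as well.

  Grouping the sets \<open>J\<close> by their size gives the binomial coefficients.
\<close>

section \<open>Restrictions of group elements to subspaces\<close>

lemma mult_weyl_group: "f \<otimes>\<^bsub>weyl_group \<Phi>\<^esub> g = g \<circ> f"
  by (simp add: weyl_group_def GL_def)

lemma mult_GL: "f \<otimes>\<^bsub>GL\<^esub> g = g \<circ> f"
  by (simp add: GL_def)

lemma one_GL: "\<one>\<^bsub>GL\<^esub> = id"
  by (simp add: GL_def)

lemma one_weyl_group: "\<one>\<^bsub>weyl_group \<Phi>\<^esub> = id"
  by (simp add: weyl_group_def GL_def)

lemma weyl_group_comp:
  "f \<in> carrier (weyl_group \<Phi>) \<Longrightarrow> g \<in> carrier (weyl_group \<Phi>) \<Longrightarrow> f \<circ> g \<in> carrier (weyl_group \<Phi>)"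
  using group.is_monoid[OF group_weyl_group, THEN monoid.m_closed, of g \<Phi> f]
  by (simp add: mult_weyl_group)

lemma weyl_group_inverse:
  assumes "g \<in> carrier (weyl_group \<Phi>)"
  obtains g' where "g' \<in> carrier (weyl_group \<Phi>)" "\<And>u. g' (g u) = u" "\<And>u. g (g' u) = u"
proof -
  interpret group "weyl_group \<Phi>" by (rule group_weyl_group)
  let ?h = "inv\<^bsub>weyl_group \<Phi>\<^esub> g"
  have "?h \<circ> g = id" "g \<circ> ?h = id"
    using r_inv[OF assms] l_inv[OF assms] by (simp_all add: mult_weyl_group one_weyl_group)
  then show ?thesis
    by (intro that[of ?h]) (use assms in \<open>auto simp: fun_eq_iff\<close>)
qed

lemma weyl_group_bij: "g \<in> carrier (weyl_group \<Phi>) \<Longrightarrow> bij g"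
  using carrier_weyl_group by (fastforce simp: GL_def)

lemma reflection_involution: "reflection v (reflection v u) = u"
  by (cases "v = 0") (auto simp: reflection_def algebra_simps inner_diff_left)

lemma linear_reflection: "linear (reflection v)"
  using reflection_in_GL[of v] by (simp add: GL_def)

lemma reflection_in_weyl_group: "v \<in> \<Phi> \<Longrightarrow> reflection v \<in> carrier (weyl_group \<Phi>)"
  unfolding weyl_group_def carrier_subgroup_generated
  using reflection_in_GL by (blast intro: generate.incl)

lemma weyl_group_mono: "\<Phi> \<subseteq> \<Psi> \<Longrightarrow> carrier (weyl_group \<Phi>) \<subseteq> carrier (weyl_group \<Psi>)"
  unfolding weyl_group_def carrier_subgroup_generated
  by (intro group.mono_generate group_GL) auto

text \<open>
  Reflections are their own inverses, so the inverses of generators need no separate case.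
\<close>

lemma weyl_group_induct [consumes 1, case_names id reflection comp]:
  assumes "g \<in> carrier (weyl_group \<Phi>)"
    and id: "P id"
    and refl: "\<And>v. v \<in> \<Phi> \<Longrightarrow> P (reflection v)"
    and comp: "\<And>f g. P f \<Longrightarrow> P g \<Longrightarrow> P (g \<circ> f)"
  shows "P g"
proof -
  have "g \<in> generate GL (carrier GL \<inter> reflection ` \<Phi>)"
    using assms(1) by (simp add: weyl_group_def carrier_subgroup_generated)
  then show ?thesis
  proof induction
    case one
    show ?case using id by (simp only: one_GL)
  next
    case (incl h)
    then show ?case using refl by auto
  next
    case (inv h)
    then obtain v where v: "v \<in> \<Phi>" "h = reflection v" by auto
    have "reflection v \<otimes>\<^bsub>GL\<^esub> reflection v = \<one>\<^bsub>GL\<^esub>"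
      by (auto simp: GL_def reflection_involution)
    then have "inv\<^bsub>GL\<^esub> h = h"
      unfolding v(2) by (intro group.inv_equality[OF group_GL] reflection_in_GL)
    then show ?case using v refl by simp
  next
    case (eng h1 h2)
    then show ?case using comp by (simp only: mult_GL)
  qed
qed

lemma partial_restrict_eq_iff:
  "partial_restrict g X = partial_restrict h Y \<longleftrightarrow> X = Y \<and> (\<forall>u\<in>X. g u = h u)"
  by (auto simp: partial_restrict_def restrict_map_def fun_eq_iff split: if_splits)

text \<open>
  Lagrange's theorem for the pointwise stabilizer of \<open>X\<close>: the fibre of the restriction map through
  \<open>g\<close> is the coset of the maps \<open>g \<circ> h\<close> where \<open>h\<close> fixes \<open>X\<close> pointwise.
\<close>

lemma card_restrictions_times_fixer:
  fixes \<Phi> :: "'a::real_inner set"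
  defines "G \<equiv> carrier (weyl_group \<Phi>)"
  assumes fin: "finite G"
  shows "card G = card ((\<lambda>g. partial_restrict g X) ` G) * card {g \<in> G. \<forall>u\<in>X. g u = u}"
proof -
  let ?r = "\<lambda>g. partial_restrict g X"
  have fibre: "card {g \<in> G. ?r g = \<rho>} = card {g \<in> G. \<forall>u\<in>X. g u = u}" if "\<rho> \<in> ?r ` G" for \<rho>
  proof -
    from that obtain g where g: "g \<in> G" "\<rho> = ?r g" by auto
    from g(1) obtain g' where g': "g' \<in> G" "\<And>u. g' (g u) = u" "\<And>u. g (g' u) = u"
      unfolding G_def using weyl_group_inverse by blast
    have "bij_betw (\<lambda>h. g' \<circ> h) {g \<in> G. ?r g = \<rho>} {g \<in> G. \<forall>u\<in>X. g u = u}"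
      by (rule bij_betw_byWitness[where f' = "\<lambda>h. g \<circ> h"])
        (use g g' in \<open>auto simp: partial_restrict_eq_iff o_def G_def
          intro: weyl_group_comp[unfolded o_def]\<close>)
    then show ?thesis by (rule bij_betw_same_card)
  qed
  have "card G = (\<Sum>g\<in>G. 1)" by simp
  also have "\<dots> = (\<Sum>\<rho>\<in>?r ` G. card {g \<in> G. ?r g = \<rho>} * 1)"
    using sum_fun_comp[of G "?r ` G" ?r "\<lambda>_. 1 :: nat"] fin by simp
  also have "\<dots> = card (?r ` G) * card {g \<in> G. \<forall>u\<in>X. g u = u}"
    using fibre by simp
  finally show ?thesis .
qed

lemma carrier_reflection_monoid:
  "carrier (reflection_monoid W S) = (\<Union>X\<in>S. (\<lambda>g. partial_restrict g X) ` carrier W)"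
  by (auto simp: reflection_monoid_def)

text \<open>
  A partial map determines its domain, so restrictions to different members of \<open>S\<close> never coincide.
\<close>

lemma card_reflection_monoid:
  assumes "finite S" "finite (carrier W)"
  shows "card (carrier (reflection_monoid W S))
    = (\<Sum>X\<in>S. card ((\<lambda>g. partial_restrict g X) ` carrier W))"
  unfolding carrier_reflection_monoid
  by (rule card_UN_disjoint) (use assms in \<open>auto simp: partial_restrict_eq_iff\<close>)

section \<open>Standard root systems\<close>

text \<open>
  The three families in one form: roots with two terms, where type \<open>A\<close> forces opposite signs, and
  in type \<open>B\<close> also the signed coordinate vectors. Replacing \<open>i < j\<close> by \<open>i \<noteq> j\<close> loses nothing, as
  the two terms may be exchanged.
\<close>

lemma standard_roots_cases:
  assumes "v \<in> standard_roots F x k"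
  obtains (two) s t i j where "s \<in> {1, -1}" "t \<in> {1, -1}" "i \<in> {1..k}" "j \<in> {1..k}" "i \<noteq> j"
      "F = Type_A \<longrightarrow> t = - s" "v = s *\<^sub>R x i + t *\<^sub>R x j"
    | (one) s i where "s \<in> {1, -1}" "i \<in> {1..k}" "F = Type_B" "v = s *\<^sub>R x i"
proof (cases F)
  case Type_A
  with assms obtain i j where "i \<in> {1..k}" "j \<in> {1..k}" "i \<noteq> j" "v = x i - x j" by auto
  then show ?thesis using Type_A by (intro two[of 1 "-1" i j]) auto
next
  case Type_B
  with assms consider s i where "v = s *\<^sub>R x i" "s \<in> {1, -1}" "i \<in> {1..k}"
    | s t i j where "v = s *\<^sub>R x i + t *\<^sub>R x j" "s \<in> {1, -1}" "t \<in> {1, -1}" "1 \<le> i" "i < j" "j \<le> k"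
    by (simp only: standard_roots.simps Un_iff mem_Collect_eq) metis
  then show ?thesis
  proof cases
    case (1 s i) then show ?thesis using Type_B by (intro one[of s i])
  next
    case (2 s t i j) then show ?thesis using Type_B by (intro two[of s t i j]) auto
  qed
next
  case Type_D
  with assms obtain s t i j where
    "v = s *\<^sub>R x i + t *\<^sub>R x j" "s \<in> {1, -1}" "t \<in> {1, -1}" "1 \<le> i" "i < j" "j \<le> k"
    by (simp only: standard_roots.simps mem_Collect_eq) metis
  then show ?thesis using Type_D by (intro two[of s t i j]) auto
qed

lemma two_term_root:
  assumes "s \<in> {1, -1}" "t \<in> {1, -1}" "i \<in> {1..k}" "j \<in> {1..k}" "i < j" "F \<noteq> Type_A"
  shows "s *\<^sub>R x i + t *\<^sub>R x j \<in> standard_roots F x k"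
proof -
  have "1 \<le> i \<and> i < j \<and> j \<le> k" using assms by simp
  then show ?thesis
    using assms(1,2,6) by (cases F) (simp_all only: standard_roots.simps, blast+)
qed

lemma difference_is_root:
  assumes "i \<in> {1..k}" "j \<in> {1..k}" "i \<noteq> j"
  shows "x i - x j \<in> standard_roots F x k"
proof (cases "F = Type_A")
  case True
  then show ?thesis using assms by auto
next
  case False
  consider "i < j" | "j < i" using assms(3) by linarith
  then show ?thesis
  proof cases
    case 1
    then show ?thesis using two_term_root[of 1 "-1" i k j F] assms False by simp
  next
    case 2
    then show ?thesis using two_term_root[of "-1" 1 j k i F] assms False by simp
  qed
qed

lemma sum_is_root:
  assumes "i \<in> {1..k}" "j \<in> {1..k}" "i < j" "F \<noteq> Type_A"
  shows "x i + x j \<in> standard_roots F x k"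
  using two_term_root[of 1 1 i k j F] assms by simp

lemma coordinate_is_root:
  assumes "i \<in> {1..k}"
  shows "x i \<in> standard_roots Type_B x k"
proof -
  have "x i = (1::real) *\<^sub>R x i \<and> (1::real) \<in> {1, -1} \<and> i \<in> {1..k}" using assms by simp
  then show ?thesis unfolding standard_roots.simps by blast
qed

lemma standard_roots_mono: "k \<le> l \<Longrightarrow> standard_roots F x k \<subseteq> standard_roots F x l"
proof (cases F)
  case Type_B
  assume "k \<le> l"
  then have "{1..k} \<subseteq> {1..l}" "j \<le> k \<Longrightarrow> j \<le> l" for j by auto
  then show ?thesis using Type_B by (simp only: standard_roots.simps) blast
next
  case Type_D
  assume "k \<le> l"
  then have "j \<le> k \<Longrightarrow> j \<le> l" for j by auto
  then show ?thesis using Type_D by (simp only: standard_roots.simps) blast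
qed fastforce

section \<open>Orthonormal frames and signed permutations\<close>

lemma exists_permutation_moving_initial_segment:
  assumes J: "J \<subseteq> {1..n}"
  obtains q where "q permutes {1..n}" "q ` {1..card J} = J"
proof -
  have fJ: "finite J" using J finite_subset by blast
  have le: "card J \<le> n" using card_mono[OF _ J] by simp
  obtain f where f: "bij_betw f {1..card J} J"
    using finite_same_card_bij[of "{1..card J}" J] fJ by auto
  have "card ({1..n} - {1..card J}) = card ({1..n} - J)"
    using le J fJ by (simp add: card_Diff_subset)
  then obtain f' where f': "bij_betw f' ({1..n} - {1..card J}) ({1..n} - J)"
    using finite_same_card_bij[of "{1..n} - {1..card J}" "{1..n} - J"] by auto
  \<comment> \<open>\<open>f\<close> and \<open>f'\<close> are glued, with the identity outside \<open>{1..n}\<close> as \<open>permutes\<close> demands.\<close>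
  define q where "q i = (if i \<in> {1..card J} then f i else if i \<in> {1..n} then f' i else i)" for i
  have q1: "bij_betw q {1..card J} J"
    using f by (rule iffD2[OF bij_betw_cong, rotated]) (auto simp: q_def)
  have q2: "bij_betw q ({1..n} - {1..card J}) ({1..n} - J)"
    using f' by (rule iffD2[OF bij_betw_cong, rotated]) (auto simp: q_def)
  have "bij_betw q ({1..card J} \<union> ({1..n} - {1..card J})) (J \<union> ({1..n} - J))"
    by (rule bij_betw_combine[OF q1 q2]) auto
  moreover have "{1..card J} \<union> ({1..n} - {1..card J}) = {1..n}" "J \<union> ({1..n} - J) = {1..n}"
    using le J by auto
  ultimately have "bij_betw q {1..n} {1..n}" by simp
  then have "q permutes {1..n}" by (rule bij_imp_permutes) (use le in \<open>auto simp: q_def\<close>)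
  then show ?thesis using q1 that by (auto simp: bij_betw_def)
qed


locale orthonormal_frame =
  fixes n :: nat and x :: "nat \<Rightarrow> 'a::euclidean_space"
  assumes orthonormal: "\<And>i j. i \<in> {1..n} \<Longrightarrow> j \<in> {1..n} \<Longrightarrow> x i \<bullet> x j = (if i = j then 1 else 0)"
    and spanning: "span (x ` {1..n}) = UNIV"
begin

text \<open>
  The difference of the two sides is orthogonal to the frame, hence to its span, hence to itself.
\<close>

lemma frame_expansion: "u = (\<Sum>i=1..n. (u \<bullet> x i) *\<^sub>R x i)"
proof -
  let ?w = "u - (\<Sum>i=1..n. (u \<bullet> x i) *\<^sub>R x i)"
  have "?w \<bullet> x j = 0" if "j \<in> {1..n}" for j
    using that by (simp add: inner_diff_left inner_sum_left orthonormal if_distrib cong: if_cong)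
  then have "orthogonal ?w v" if "v \<in> span (x ` {1..n})" for v
    by (intro orthogonal_to_span[OF that]) (auto simp: orthogonal_def)
  then have "orthogonal ?w ?w" using spanning by simp
  then show ?thesis by (simp add: orthogonal_self)
qed

lemma frame_linear_eqI:
  assumes "linear f" "linear g" "\<And>i. i \<in> {1..n} \<Longrightarrow> f (x i) = g (x i)"
  shows "f = g"
proof
  fix u
  show "f u = g u"
    by (rule linear_eq_on[OF assms(1,2), of u "x ` {1..n}"]) (use assms(3) spanning in auto)
qed

lemma scaled_frame_eqD:
  assumes "a *\<^sub>R x i = b *\<^sub>R x j" "i \<in> {1..n}" "j \<in> {1..n}" "a \<noteq> 0"
  shows "i = j \<and> a = b"
proof -
  have "(a *\<^sub>R x i) \<bullet> x i = (b *\<^sub>R x j) \<bullet> x i" using assms(1) by simp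
  then show ?thesis using assms(2-4) by (auto simp: orthonormal split: if_splits)
qed

definition coord_subspace :: "nat set \<Rightarrow> 'a set" where
  "coord_subspace J = {u. \<forall>i\<in>J. u \<bullet> x i = 0}"

lemma frame_mem_coord_subspace:
  "i \<in> {1..n} \<Longrightarrow> J \<subseteq> {1..n} \<Longrightarrow> x i \<in> coord_subspace J \<longleftrightarrow> i \<notin> J"
  by (auto simp: coord_subspace_def orthonormal subset_iff)

lemma inj_on_coord_subspace: "inj_on coord_subspace (Pow {1..n})"
proof (rule inj_onI)
  fix I J assume IJ: "I \<in> Pow {1..n}" "J \<in> Pow {1..n}" "coord_subspace I = coord_subspace J"
  then have "i \<in> I \<longleftrightarrow> i \<in> J" if "i \<in> {1..n}" for i
    using frame_mem_coord_subspace[OF that] by blast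
  then show "I = J" using IJ by blast
qed

text \<open>
  The coordinate subspace is spanned by the \<open>x i\<close> with \<open>i \<notin> J\<close>; pointwise stabilizers thus become
  conditions on vectors of the frame.
\<close>

lemma linear_eq_on_coord_subspace_iff:
  assumes "linear f" "linear g" "J \<subseteq> {1..n}"
  shows "(\<forall>u\<in>coord_subspace J. f u = g u) \<longleftrightarrow> (\<forall>i\<in>{1..n} - J. f (x i) = g (x i))"
proof
  assume "\<forall>u\<in>coord_subspace J. f u = g u"
  then show "\<forall>i\<in>{1..n} - J. f (x i) = g (x i)"
    using frame_mem_coord_subspace assms(3) by auto
next
  assume eq: "\<forall>i\<in>{1..n} - J. f (x i) = g (x i)"
  show "\<forall>u\<in>coord_subspace J. f u = g u"
  proof
    fix u assume u: "u \<in> coord_subspace J"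
    have "f (\<Sum>i=1..n. (u \<bullet> x i) *\<^sub>R x i) = g (\<Sum>i=1..n. (u \<bullet> x i) *\<^sub>R x i)"
      unfolding linear_sum[OF assms(1)] linear_sum[OF assms(2)]
        linear_cmul[OF assms(1)] linear_cmul[OF assms(2)]
      by (rule sum.cong) (use u eq in \<open>auto simp: coord_subspace_def\<close>)
    then show "f u = g u" using frame_expansion[of u] by simp
  qed
qed

text \<open>
  The signs with which the Weyl group of each family can act on the frame. A product of signs is \<open>1\<close>
  exactly if evenly many of them are negative, and it is multiplicative under composition.
\<close>

definition admissible_signs :: "root_family \<Rightarrow> (nat \<Rightarrow> real) \<Rightarrow> bool" where
  "admissible_signs F e \<longleftrightarrow>
     (\<forall>i\<in>{1..n}. e i \<in> {1, -1}) \<and>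
     (F = Type_A \<longrightarrow> (\<forall>i\<in>{1..n}. e i = 1)) \<and>
     (F = Type_D \<longrightarrow> prod e {1..n} = 1)"

definition signed_permutation :: "root_family \<Rightarrow> ('a \<Rightarrow> 'a) \<Rightarrow> bool" where
  "signed_permutation F g \<longleftrightarrow> linear g \<and>
     (\<exists>p e. p permutes {1..n} \<and> admissible_signs F e \<and> (\<forall>i\<in>{1..n}. g (x i) = e i *\<^sub>R x (p i)))"

lemma admissible_signsD: "admissible_signs F e \<Longrightarrow> i \<in> {1..n} \<Longrightarrow> e i = 1 \<or> e i = -1"
  by (auto simp: admissible_signs_def)

lemma signed_permutation_linear: "signed_permutation F g \<Longrightarrow> linear g"
  by (simp add: signed_permutation_def)

lemma signed_permutation_id: "signed_permutation F id"
  unfolding signed_permutation_def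
  using linear_id permutes_id
  by (intro conjI exI[of _ id] exI[of _ "\<lambda>_. 1"]) (auto simp: admissible_signs_def id_def)

text \<open>
  The sign at \<open>i\<close> of the composite is \<open>e i * d (p i)\<close>. In type \<open>D\<close> the second factor is reindexed
  by the permutation \<open>p\<close>, which leaves the product over all \<open>i\<close> unchanged.
\<close>

lemma signed_permutation_comp:
  assumes "signed_permutation F f" "signed_permutation F g"
  shows "signed_permutation F (g \<circ> f)"
proof -
  from assms(1) obtain p e where f: "linear f" "p permutes {1..n}" "admissible_signs F e"
    "\<And>i. i \<in> {1..n} \<Longrightarrow> f (x i) = e i *\<^sub>R x (p i)"
    by (auto simp: signed_permutation_def)
  from assms(2) obtain q d where g: "linear g" "q permutes {1..n}" "admissible_signs F d"
    "\<And>i. i \<in> {1..n} \<Longrightarrow> g (x i) = d i *\<^sub>R x (q i)"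
    by (auto simp: signed_permutation_def)
  have p: "p i \<in> {1..n}" if "i \<in> {1..n}" for i
    using that permutes_in_image[OF f(2)] by blast
  have "prod (\<lambda>i. e i * d (p i)) {1..n} = prod e {1..n} * prod d {1..n}"
    using prod.permute[OF f(2), of d] by (simp add: prod.distrib o_def)
  moreover have "e i * d (p i) \<in> {1, -1}" if "i \<in> {1..n}" for i
    using that p[OF that] f(3) g(3) admissible_signsD[of F e i] admissible_signsD[of F d "p i"] by auto
  ultimately have "admissible_signs F (\<lambda>i. e i * d (p i))"
    using f(3) g(3) p unfolding admissible_signs_def by simp
  moreover have "(g \<circ> f) (x i) = (e i * d (p i)) *\<^sub>R x ((q \<circ> p) i)" if "i \<in> {1..n}" for i
    using that p[OF that] f(4) g(4) by (simp add: linear_cmul[OF g(1)])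
  ultimately show ?thesis
    unfolding signed_permutation_def
    using linear_compose[OF f(1) g(1)] permutes_compose[OF f(2) g(2)] by blast
qed

text \<open>
  A linear map is determined by its values on the frame, and a signed permutation has only finitely
  many values available there.
\<close>

lemma finite_signed_permutations: "finite {g. signed_permutation F g}"
proof -
  let ?T = "x ` {1..n} \<union> uminus ` x ` {1..n}"
  let ?\<phi> = "\<lambda>g. restrict (g \<circ> x) {1..n}"
  have "inj_on ?\<phi> {g. signed_permutation F g}"
  proof (rule inj_onI)
    fix f g assume *: "f \<in> {g. signed_permutation F g}" "g \<in> {g. signed_permutation F g}" "?\<phi> f = ?\<phi> g"
    show "f = g"
    proof (rule frame_linear_eqI)
      fix i assume "i \<in> {1..n}"
      then show "f (x i) = g (x i)" using fun_cong[OF *(3), of i] by simp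
    qed (use * signed_permutation_linear in auto)
  qed
  moreover have "?\<phi> ` {g. signed_permutation F g} \<subseteq> {1..n} \<rightarrow>\<^sub>E ?T"
  proof (intro image_subsetI PiE_I)
    fix g i assume "g \<in> {g. signed_permutation F g}" and i: "i \<in> {1..n}"
    then obtain p e where "p permutes {1..n}" "admissible_signs F e" "g (x i) = e i *\<^sub>R x (p i)"
      by (auto simp: signed_permutation_def)
    then show "?\<phi> g i \<in> ?T"
      using admissible_signsD[of F e i] permutes_in_image[of p "{1..n}" i] i by auto
  qed auto
  moreover have "finite ({1..n} \<rightarrow>\<^sub>E ?T)" by (intro finite_PiE) auto
  ultimately show ?thesis using finite_imageD finite_subset by blast
qed

text \<open>
  If \<open>g\<close> sends \<open>x i\<close> to \<open>\<plusminus>x (p i)\<close>, then the coordinate of \<open>g u\<close> at \<open>p i\<close> is up to sign the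
  coordinate of \<open>u\<close> at \<open>i\<close>, so \<open>K = p ` J\<close> works.
\<close>

lemma signed_permutation_image_coord_subspace:
  assumes "signed_permutation F g" "bij g" "J \<subseteq> {1..n}"
  shows "\<exists>K\<subseteq>{1..n}. g ` coord_subspace J = coord_subspace K"
proof -
  from assms(1) obtain p e where g: "linear g" "p permutes {1..n}" "admissible_signs F e"
    "\<And>i. i \<in> {1..n} \<Longrightarrow> g (x i) = e i *\<^sub>R x (p i)"
    by (auto simp: signed_permutation_def)
  have p: "p i \<in> {1..n}" if "i \<in> {1..n}" for i
    using that permutes_in_image[OF g(2)] by blast
  have inner: "g u \<bullet> x (p i) = e i * (u \<bullet> x i)" if i: "i \<in> {1..n}" for u i
  proof -
    have "g u = g (\<Sum>m=1..n. (u \<bullet> x m) *\<^sub>R x m)" using frame_expansion[of u] by simp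
    also have "\<dots> = (\<Sum>m=1..n. (u \<bullet> x m) *\<^sub>R e m *\<^sub>R x (p m))"
      unfolding linear_sum[OF g(1)] linear_cmul[OF g(1)] by (intro sum.cong) (auto simp: g(4))
    finally have "g u \<bullet> x (p i) = (\<Sum>m=1..n. (u \<bullet> x m) * (e m * (x (p m) \<bullet> x (p i))))"
      by (simp add: inner_sum_left mult.assoc)
    also have "\<dots> = (\<Sum>m=1..n. if m = i then e i * (u \<bullet> x i) else 0)"
      using i p permutes_inj[OF g(2)] by (intro sum.cong) (auto simp: orthonormal inj_eq)
    finally show ?thesis using i by simp
  qed
  have "g u \<bullet> x (p i) = 0 \<longleftrightarrow> u \<bullet> x i = 0" if "i \<in> J" for u i
    using that subsetD[OF assms(3) that] inner[of i u] admissible_signsD[OF g(3), of i] by auto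
  then have mem: "g u \<in> coord_subspace (p ` J) \<longleftrightarrow> u \<in> coord_subspace J" for u
    by (simp add: coord_subspace_def)
  have "g ` coord_subspace J = coord_subspace (p ` J)"
  proof (intro equalityI subsetI)
    fix v assume v: "v \<in> coord_subspace (p ` J)"
    obtain u where "v = g u" using assms(2) by (metis bij_pointE)
    then show "v \<in> g ` coord_subspace J" using v mem by auto
  qed (use mem in auto)
  moreover have "p ` J \<subseteq> {1..n}" using p assms(3) by blast
  ultimately show ?thesis by (intro exI conjI)
qed

section \<open>The Weyl groups as groups of signed permutations\<close>

text \<open>
  The reflection in \<open>s *\<^sub>R x i + t *\<^sub>R x j\<close> exchanges \<open>x i\<close> and \<open>x j\<close>, with sign \<open>- (s * t)\<close> on both.
  The two signs are equal, so the product of all signs is \<open>1\<close>; this is the parity condition of type \<open>D\<close>.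
\<close>

lemma reflection_two:
  assumes "s \<in> {1, -1}" "t \<in> {1, -1}" "i \<in> {1..n}" "j \<in> {1..n}" "i \<noteq> j" "m \<in> {1..n}"
  shows "reflection (s *\<^sub>R x i + t *\<^sub>R x j) (x m) =
    (if m \<in> {i, j} then - (s * t) else 1) *\<^sub>R x (Transposition.transpose i j m)"
  using assms
  by (auto simp: reflection_def inner_add_left inner_add_right orthonormal inner_diff_left inner_diff_right
      algebra_simps Transposition.transpose_def)

lemma reflection_one:
  assumes "s \<in> {1, -1}" "i \<in> {1..n}" "m \<in> {1..n}"
  shows "reflection (s *\<^sub>R x i) (x m) = (if m = i then -1 else 1) *\<^sub>R x m"
  using assms by (auto simp: reflection_def orthonormal scaleR_2)

lemma signed_permutation_reflection:
  assumes "v \<in> standard_roots F x n"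
  shows "signed_permutation F (reflection v)"
  using assms
proof (cases rule: standard_roots_cases)
  case (two s t i j)
  let ?e = "\<lambda>m. if m \<in> {i, j} then - (s * t) else 1 :: real"
  have st: "s * t = 1 \<or> s * t = -1" using two(1,2) by auto
  have "prod ?e {1..n} = prod ?e {i, j}"
    by (rule prod.mono_neutral_right) (use two in auto)
  then have "prod ?e {1..n} = 1" using st two(5) by auto
  moreover have "?e m \<in> {1, -1}" for m using st by auto
  moreover have "?e m = 1" if "F = Type_A" for m using two(1,6) that by auto
  ultimately have "admissible_signs F ?e"
    unfolding admissible_signs_def by blast
  moreover have "Transposition.transpose i j permutes {1..n}" using two by (simp add: permutes_swap_id)
  ultimately show ?thesis
    unfolding signed_permutation_def using reflection_two[of s t i j] two linear_reflection by blast
next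
  case (one s i)
  have "admissible_signs F (\<lambda>m. if m = i then -1 else 1)"
    using one by (auto simp: admissible_signs_def)
  then show ?thesis
    unfolding signed_permutation_def using reflection_one[of s i] one linear_reflection permutes_id[of "{1..n}"]
    by (auto intro!: exI[of _ id] exI[of _ "\<lambda>m. if m = i then -1 else (1::real)"])
qed

lemma reflection_fixes_later:
  assumes "v \<in> standard_roots F x k" "k \<le> n" "m \<in> {k<..n}"
  shows "reflection v (x m) = x m"
  using assms(1)
proof (cases rule: standard_roots_cases)
  case (two s t i j)
  then show ?thesis using assms reflection_two[of s t i j m] by (simp add: Transposition.transpose_def)
next
  case (one s i)
  then show ?thesis using assms reflection_one[of s i m] by simp
qed

text \<open>
  Signed permutations of all \<open>n\<close> vectors are used for every \<open>k\<close>, with the later vectors fixed. In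
  this form the Weyl group of index \<open>k\<close> is visibly a pointwise stabilizer in the one of index \<open>n\<close>.
\<close>

definition fixing_signed_permutations :: "root_family \<Rightarrow> nat \<Rightarrow> ('a \<Rightarrow> 'a) set" where
  "fixing_signed_permutations F k = {g. signed_permutation F g \<and> (\<forall>i\<in>{k<..n}. g (x i) = x i)}"

lemma weyl_group_subset_signed_permutations:
  assumes "k \<le> n"
  shows "carrier (weyl_group (standard_roots F x k)) \<subseteq> fixing_signed_permutations F k"
proof
  fix g assume "g \<in> carrier (weyl_group (standard_roots F x k))"
  then show "g \<in> fixing_signed_permutations F k"
  proof (induction rule: weyl_group_induct)
    case id
    show ?case using signed_permutation_id by (simp add: fixing_signed_permutations_def id_def)
  next
    case (reflection v)
    then have "signed_permutation F (reflection v)"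
      using standard_roots_mono[OF assms] signed_permutation_reflection by blast
    then show ?case
      using reflection_fixes_later[OF reflection assms] by (simp add: fixing_signed_permutations_def)
  next
    case (comp f g)
    then show ?case
      unfolding fixing_signed_permutations_def mem_Collect_eq
      by (intro conjI signed_permutation_comp) simp_all
  qed
qed

text \<open>
  The index \<open>j\<close> cannot exceed \<open>Suc k\<close>, since a later \<open>x j\<close> is already the image of itself. The last
  clause is what the induction below needs at \<open>k = 0\<close> in type \<open>D\<close>: if only one sign can be
  negative, then parity excludes it.
\<close>

lemma signed_permutation_image_last:
  assumes k: "Suc k \<le> n" and g: "g \<in> fixing_signed_permutations F (Suc k)"
  obtains s j where "s \<in> {1, -1}" "j \<in> {1..Suc k}" "g (x (Suc k)) = s *\<^sub>R x j" "F = Type_A \<longrightarrow> s = 1"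
    "F = Type_D \<Longrightarrow> k = 0 \<Longrightarrow> s = 1"
proof -
  from g obtain p e where g: "linear g" "p permutes {1..n}" "admissible_signs F e"
    "\<And>i. i \<in> {1..n} \<Longrightarrow> g (x i) = e i *\<^sub>R x (p i)" "\<And>i. i \<in> {Suc k<..n} \<Longrightarrow> g (x i) = x i"
    by (auto simp: signed_permutation_def fixing_signed_permutations_def)
  have p: "p i \<in> {1..n}" if "i \<in> {1..n}" for i
    using that permutes_in_image[OF g(2)] by blast
  have later: "p i = i \<and> e i = 1" if i: "i \<in> {Suc k<..n}" for i
  proof -
    have "1 *\<^sub>R x i = e i *\<^sub>R x (p i)" using g(4)[of i] g(5)[OF i] i by simp
    from scaled_frame_eqD[OF this] show ?thesis using i p[of i] by simp
  qed
  let ?j = "p (Suc k)"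
  have "?j \<le> Suc k"
  proof (rule ccontr)
    assume "\<not> ?j \<le> Suc k"
    then have "p ?j = ?j" using later p[of "Suc k"] k by simp
    then have "?j = Suc k" using permutes_inj[OF g(2)] by (simp add: inj_eq)
    with \<open>\<not> ?j \<le> Suc k\<close> show False by simp
  qed
  moreover have "e (Suc k) = 1" if "F = Type_D" "k = 0"
  proof -
    have "prod e {1..n} = prod e {1}"
      by (rule prod.mono_neutral_right) (use later k that in auto)
    then show ?thesis using g(3) that by (simp add: admissible_signs_def)
  qed
  ultimately show ?thesis
    using g(3) g(4)[of "Suc k"] p[of "Suc k"] k
    by (intro that[of "e (Suc k)" ?j]) (auto simp: admissible_signs_def)
qed

text \<open>
  In the induction step, composing with a suitable reflection of index \<open>Suc k\<close> turns \<open>g\<close> into a map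
  that also fixes \<open>x (Suc k)\<close>, to which the induction hypothesis applies. Which root is suitable
  depends on the image \<open>\<plusminus>x j\<close> of \<open>x (Suc k)\<close>: for \<open>j \<noteq> Suc k\<close> it is \<open>x j - x (Suc k)\<close> or
  \<open>x j + x (Suc k)\<close>, according to the sign. If \<open>x (Suc k)\<close> is sent to its negative, type \<open>B\<close> has
  the root \<open>x (Suc k)\<close> itself, while in type \<open>D\<close> a first reflection in \<open>x 1 + x (Suc k)\<close> leads
  back to the case \<open>j = 1\<close>.
\<close>

lemma fixing_signed_permutations_in_weyl_group:
  assumes "k \<le> n" "g \<in> fixing_signed_permutations F k"
  shows "g \<in> carrier (weyl_group (standard_roots F x k))"
  using assms
proof (induction k arbitrary: g)
  case 0
  have "linear g" "linear (id :: 'a \<Rightarrow> 'a)"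
    using 0 linear_id by (auto simp: fixing_signed_permutations_def signed_permutation_linear id_def)
  then have "g = id" using 0 by (intro frame_linear_eqI) (auto simp: fixing_signed_permutations_def)
  then show ?case
    using group.is_monoid[OF group_weyl_group, THEN monoid.one_closed] one_weyl_group by metis
next
  case (Suc k)
  let ?R = "standard_roots F x (Suc k)"
  let ?W = "carrier (weyl_group ?R)"
  let ?G = "fixing_signed_permutations F (Suc k)"
  have k: "Suc k \<in> {1..n}" using Suc.prems by simp
  have reflect: "reflection v \<circ> h \<in> ?G" if "v \<in> ?R" "h \<in> ?G" for v h
    using that(2) weyl_group_subset_signed_permutations[OF Suc.prems(1), of F]
      reflection_in_weyl_group[OF that(1)]
    by (auto simp: fixing_signed_permutations_def intro: signed_permutation_comp)
  \<comment> \<open>A reflection can be cancelled from a composite, being an involution in the group.\<close>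
  have undo: "h \<in> ?W" if "v \<in> ?R" "reflection v \<circ> h \<in> ?W" for v h
  proof -
    have "reflection v \<circ> (reflection v \<circ> h) \<in> ?W"
      by (rule weyl_group_comp[OF reflection_in_weyl_group[OF that(1)] that(2)])
    moreover have "reflection v \<circ> (reflection v \<circ> h) = h"
      by (rule ext) (simp add: reflection_involution)
    ultimately show ?thesis by (simp only:)
  qed
  have fixed: "h \<in> ?W" if h: "h \<in> ?G" "h (x (Suc k)) = x (Suc k)" for h
  proof -
    have "h (x i) = x i" if "i \<in> {k<..n}" for i
      using h that by (cases "i = Suc k") (auto simp: fixing_signed_permutations_def)
    then have "h \<in> fixing_signed_permutations F k"
      using h(1) by (simp add: fixing_signed_permutations_def)
    then have "h \<in> carrier (weyl_group (standard_roots F x k))"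
      using Suc.IH Suc.prems(1) by simp
    moreover have "carrier (weyl_group (standard_roots F x k)) \<subseteq> ?W"
      by (intro weyl_group_mono standard_roots_mono) simp
    ultimately show ?thesis by blast
  qed
  have pos: "h \<in> ?W" if h: "h \<in> ?G" "h (x (Suc k)) = x j" "j \<in> {1..k}" for h j
  proof -
    have v: "x j - x (Suc k) \<in> ?R" using h by (intro difference_is_root) auto
    have "reflection (x j - x (Suc k)) (x j) = x (Suc k)"
      using reflection_two[of 1 "-1" j "Suc k" j] h k Suc.prems by auto
    then have "(reflection (x j - x (Suc k)) \<circ> h) (x (Suc k)) = x (Suc k)"
      using h by simp
    then show ?thesis using undo[OF v] fixed reflect[OF v] h by blast
  qed
  have neg: "h \<in> ?W" if h: "h \<in> ?G" "h (x (Suc k)) = - x j" "j \<in> {1..k}" "F \<noteq> Type_A" for h j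
  proof -
    have v: "x j + x (Suc k) \<in> ?R" using h by (intro sum_is_root) auto
    have "reflection (x j + x (Suc k)) (x j) = - x (Suc k)"
      using reflection_two[of 1 1 j "Suc k" j] h k Suc.prems by auto
    then have "(reflection (x j + x (Suc k)) \<circ> h) (x (Suc k)) = x (Suc k)"
      using h by (simp add: linear_neg[OF linear_reflection])
    then show ?thesis using undo[OF v] fixed reflect[OF v] h by blast
  qed
  from signed_permutation_image_last[OF Suc.prems] obtain s j where
    s: "s \<in> {1, -1}" "F = Type_A \<longrightarrow> s = 1" "F = Type_D \<longrightarrow> k = 0 \<longrightarrow> s = 1"
    and j: "j \<in> {1..Suc k}" "g (x (Suc k)) = s *\<^sub>R x j" by metis
  consider "s = 1" "j = Suc k" | "s = 1" "j \<in> {1..k}" | "s = -1" "j \<in> {1..k}"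
    | "s = -1" "j = Suc k" "F = Type_B" | "s = -1" "j = Suc k" "F = Type_D" "k \<noteq> 0"
    using s j by (cases F; cases "j = Suc k") auto
  then show ?case
  proof cases
    case 1
    then show ?thesis using fixed Suc.prems j by simp
  next
    case 2
    then show ?thesis using pos Suc.prems j by simp
  next
    case 3
    then have "F \<noteq> Type_A" using s by auto
    then show ?thesis using 3 neg Suc.prems j by simp
  next
    case 4
    then have v: "x (Suc k) \<in> ?R" using coordinate_is_root[of "Suc k" "Suc k"] by simp
    have "(reflection (x (Suc k)) \<circ> g) (x (Suc k)) = x (Suc k)"
      using reflection_one[of 1 "Suc k" "Suc k"] k 4 j by (simp add: linear_neg[OF linear_reflection])
    then show ?thesis using undo[OF v] fixed reflect[OF v] Suc.prems by blast
  next
    case 5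
    have v: "x 1 + x (Suc k) \<in> ?R" using 5 by (intro sum_is_root) auto
    have "reflection (x 1 + x (Suc k)) (x (Suc k)) = - x 1"
      using reflection_two[of 1 1 1 "Suc k" "Suc k"] k 5 by auto
    then have "(reflection (x 1 + x (Suc k)) \<circ> g) (x (Suc k)) = x 1"
      using j 5 by (simp add: linear_neg[OF linear_reflection])
    then show ?thesis using undo[OF v] pos[of _ 1] reflect[OF v] Suc.prems 5 by simp
  qed
qed

lemma carrier_weyl_group_standard:
  assumes "k \<le> n"
  shows "carrier (weyl_group (standard_roots F x k)) = fixing_signed_permutations F k"
  using weyl_group_subset_signed_permutations fixing_signed_permutations_in_weyl_group assms by blast

lemma carrier_weyl_group_full:
  "carrier (weyl_group (standard_roots F x n)) = {g. signed_permutation F g}"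
  using carrier_weyl_group_standard[of n F] by (simp add: fixing_signed_permutations_def)

section \<open>The Boolean system and the pointwise stabilizers of its members\<close>

lemma boolean_system_eq:
  "boolean_system (weyl_group (standard_roots F x n)) x n = coord_subspace ` Pow {1..n}"
  unfolding boolean_system_def
proof (rule hull_unique)
  show "(\<lambda>i. {u. u \<bullet> x i = 0}) ` {1..n} \<subseteq> coord_subspace ` Pow {1..n}"
  proof (rule image_subsetI)
    fix i assume "i \<in> {1..n}"
    then show "{u. u \<bullet> x i = 0} \<in> coord_subspace ` Pow {1..n}"
      by (intro image_eqI[of _ _ "{i}"]) (auto simp: coord_subspace_def)
  qed
  have image: "g ` coord_subspace J \<in> coord_subspace ` Pow {1..n}"
    if g: "g \<in> carrier (weyl_group (standard_roots F x n))" and J: "J \<subseteq> {1..n}" for g J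
  proof -
    have "signed_permutation F g" using g by (simp only: carrier_weyl_group_full mem_Collect_eq)
    moreover have "bij g" using g by (rule weyl_group_bij)
    ultimately have "\<exists>K\<subseteq>{1..n}. g ` coord_subspace J = coord_subspace K"
      using J by (rule signed_permutation_image_coord_subspace)
    then obtain K where "K \<subseteq> {1..n} \<and> g ` coord_subspace J = coord_subspace K" by (rule exE)
    then show ?thesis by simp
  qed
  have inter: "coord_subspace I \<inter> coord_subspace J \<in> coord_subspace ` Pow {1..n}"
    if "I \<subseteq> {1..n}" "J \<subseteq> {1..n}" for I J
  proof (rule image_eqI)
    show "coord_subspace I \<inter> coord_subspace J = coord_subspace (I \<union> J)"
      by (auto simp: coord_subspace_def)
  qed (use that in blast)
  have subspace: "subspace (coord_subspace J)" for J
    by (simp add: coord_subspace_def subspace_def inner_add_left)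
  have "UNIV = coord_subspace {}" by (simp add: coord_subspace_def)
  then have "UNIV \<in> coord_subspace ` Pow {1..n}" by (rule image_eqI) simp
  then show "subspace_system (weyl_group (standard_roots F x n)) (coord_subspace ` Pow {1..n})"
    unfolding subspace_system_def ball_simps(9) using subspace image inter by blast
next
  fix T
  assume gen: "(\<lambda>i. {u. u \<bullet> x i = 0}) ` {1..n} \<subseteq> T"
    and T: "subspace_system (weyl_group (standard_roots F x n)) T"
  have "coord_subspace J \<in> T" if "finite J" "J \<subseteq> {1..n}" for J
    using that
  proof (induction J)
    case empty
    then show ?case using T by (simp add: coord_subspace_def subspace_system_def)
  next
    case (insert i J)
    have "coord_subspace (insert i J) = {u. u \<bullet> x i = 0} \<inter> coord_subspace J"
      by (auto simp: coord_subspace_def)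
    moreover have "{u. u \<bullet> x i = 0} \<in> T" using gen insert by auto
    ultimately show ?case using T insert by (simp add: subspace_system_def)
  qed
  then show "coord_subspace ` Pow {1..n} \<subseteq> T"
    using finite_subset by blast
qed

text \<open>
  A permutation of the frame without signs is admissible in all three families.
\<close>

lemma signed_permutation_of_permutation:
  assumes "q permutes {1..n}"
  obtains w where "signed_permutation F w" "\<And>i. i \<in> {1..n} \<Longrightarrow> w (x i) = x (q i)"
proof -
  let ?w = "\<lambda>u. \<Sum>i=1..n. (u \<bullet> x i) *\<^sub>R x (q i)"
  have "linear ?w"
    by (rule linear_compose_sum, rule ballI, rule linearI)
      (simp_all only: inner_add_left scaleR_add_left inner_scaleR_left scaleR_scaleR)
  moreover have image: "?w (x i) = x (q i)" if "i \<in> {1..n}" for i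
  proof -
    have "?w (x i) = (\<Sum>m=1..n. if m = i then x (q i) else 0)"
      by (rule sum.cong[OF refl]) (simp only: that orthonormal, simp)
    then show ?thesis using that by simp
  qed
  moreover have "admissible_signs F (\<lambda>_. 1)" by (simp add: admissible_signs_def)
  ultimately have "signed_permutation F ?w"
    unfolding signed_permutation_def using assms
    by (intro conjI exI[of _ q] exI[of _ "\<lambda>_. 1"]) simp_all
  then show ?thesis using image by (rule that)
qed

text \<open>
  Conjugation by a permutation \<open>w\<close> of the frame that carries \<open>{1..card J}\<close> to \<open>J\<close> also carries the
  remaining indices to those outside \<open>J\<close>, hence maps one pointwise stabilizer onto the other.
\<close>

lemma card_fixer_coord_subspace:
  assumes J: "J \<subseteq> {1..n}"
  shows "card {g \<in> carrier (weyl_group (standard_roots F x n)). \<forall>u\<in>coord_subspace J. g u = u}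
    = card (carrier (weyl_group (standard_roots F x (card J))))"
proof -
  have le: "card J \<le> n" using card_mono[OF _ J] by simp
  obtain q where q: "q permutes {1..n}" "q ` {1..card J} = J"
    using exists_permutation_moving_initial_segment[OF J] .
  have q_mem: "q i \<in> {1..n} - J \<longleftrightarrow> i \<in> {card J<..n}" for i
    using permutes_in_image[OF q(1), of i] permutes_inj[OF q(1)] q(2) le
    by (force simp: inj_eq)
  have qinv: "inv_into UNIV q i \<in> {card J<..n}" if "i \<in> {1..n} - J" for i
    using that q_mem[of "inv_into UNIV q i"] permutes_inverses[OF q(1)] by simp
  obtain w where w: "signed_permutation F w" "\<And>i. i \<in> {1..n} \<Longrightarrow> w (x i) = x (q i)"
    using signed_permutation_of_permutation[OF q(1)] by blast
  obtain w' where w': "signed_permutation F w'" "\<And>i. i \<in> {1..n} \<Longrightarrow> w' (x i) = x (inv_into UNIV q i)"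
    using signed_permutation_of_permutation[OF permutes_inv[OF q(1)]] by blast
  have mem: "q i \<in> {1..n}" "inv_into UNIV q i \<in> {1..n}" if "i \<in> {1..n}" for i
    using that permutes_in_image[OF q(1)] permutes_in_image[OF permutes_inv[OF q(1)]] by blast+
  have "w' \<circ> w = id" "w \<circ> w' = id"
    using w w' mem permutes_inverses[OF q(1)]
    by (intro frame_linear_eqI signed_permutation_linear[of F] signed_permutation_comp
        signed_permutation_id; simp)+
  then have inverse: "w' (w u) = u" "w (w' u) = u" for u by (auto simp: fun_eq_iff)
  let ?A = "{g. signed_permutation F g \<and> (\<forall>i\<in>{1..n} - J. g (x i) = x i)}"
  have to: "w \<circ> g \<circ> w' \<in> ?A" if g: "g \<in> fixing_signed_permutations F (card J)" for g
  proof -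
    have "(w \<circ> g \<circ> w') (x i) = x i" if i: "i \<in> {1..n} - J" for i
      using g qinv[OF i] i mem(2)[of i] w(2) w'(2) permutes_inverses[OF q(1)]
      by (simp add: fixing_signed_permutations_def)
    moreover have "signed_permutation F (w \<circ> g \<circ> w')"
      using g w(1) w'(1) by (intro signed_permutation_comp) (simp_all add: fixing_signed_permutations_def)
    ultimately show ?thesis by simp
  qed
  have fro: "w' \<circ> g \<circ> w \<in> fixing_signed_permutations F (card J)" if g: "g \<in> ?A" for g
  proof -
    have "(w' \<circ> g \<circ> w) (x i) = x i" if i: "i \<in> {card J<..n}" for i
    proof -
      have "q i \<in> {1..n} - J" "i \<in> {1..n}" using i q_mem by auto
      then show ?thesis using g w(2) w'(2) permutes_inverses[OF q(1)] by simp
    qed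
    moreover have "signed_permutation F (w' \<circ> g \<circ> w)"
      using g w(1) w'(1) by (intro signed_permutation_comp) simp_all
    ultimately show ?thesis by (simp add: fixing_signed_permutations_def)
  qed
  have "bij_betw (\<lambda>g. w \<circ> g \<circ> w') (fixing_signed_permutations F (card J)) ?A"
    by (rule bij_betw_byWitness[where f' = "\<lambda>g. w' \<circ> g \<circ> w"])
      (use to fro inverse in \<open>auto simp: fun_eq_iff\<close>)
  moreover have "{g \<in> carrier (weyl_group (standard_roots F x n)). \<forall>u\<in>coord_subspace J. g u = u} = ?A"
    using linear_eq_on_coord_subspace_iff[OF signed_permutation_linear linear_id J]
    by (auto simp: carrier_weyl_group_full)
  ultimately show ?thesis
    by (simp add: carrier_weyl_group_standard[OF le] bij_betw_same_card)
qed

lemma finite_weyl_group_standard: "k \<le> n \<Longrightarrow> finite (carrier (weyl_group (standard_roots F x k)))"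
  by (rule finite_subset[OF _ finite_signed_permutations[of F]])
    (auto simp: carrier_weyl_group_standard fixing_signed_permutations_def)

end

section \<open>The order of the Boolean reflection monoid\<close>

theorem theorem2:
  fixes F :: root_family
    and n :: nat
    and x :: "nat \<Rightarrow> 'a::euclidean_space"
  assumes n: "n \<ge> (case F of Type_A \<Rightarrow> 2 | Type_B \<Rightarrow> 2 | Type_D \<Rightarrow> 4)"
    and orthonormal: "\<And>i j. i \<in> {1..n} \<Longrightarrow> j \<in> {1..n} \<Longrightarrow> x i \<bullet> x j = (if i = j then 1 else 0)"
    and spanning: "span (x ` {1..n}) = UNIV"
  defines "W \<equiv> \<lambda>k. weyl_group (standard_roots F x k)"
  defines "M \<equiv> reflection_monoid (W n) (boolean_system (W n) x n)"
  shows "finite (carrier M) \<and>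
    real (Coset.order M) =
      real (Coset.order (W n)) * (\<Sum>k=0..n. real (n choose k) * (1 / real (Coset.order (W k))))"
proof -
  interpret orthonormal_frame n x
    using orthonormal spanning by unfold_locales
  let ?B = "coord_subspace ` Pow {1..n}"
  let ?R = "\<lambda>X. (\<lambda>g. partial_restrict g X) ` carrier (W n)"
  have M: "M = reflection_monoid (W n) ?B"
    by (simp add: M_def W_def boolean_system_eq)
  have fin: "finite (carrier (W n))"
    by (simp add: W_def finite_weyl_group_standard)
  have pos: "card (carrier (W k)) > 0" if "k \<le> n" for k
    using finite_weyl_group_standard[OF that, of F] group.is_monoid[OF group_weyl_group]
    by (auto simp: W_def card_gt_0_iff dest: monoid.one_closed)
  have restrictions: "real (card (?R (coord_subspace J)))
      = real (card (carrier (W n))) * (1 / real (card (carrier (W (card J)))))"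
    if "J \<in> Pow {1..n}" for J
  proof -
    have J: "J \<subseteq> {1..n}" using that by simp
    have "card (carrier (W n)) = card (?R (coord_subspace J)) * card (carrier (W (card J)))"
      using card_restrictions_times_fixer[of "standard_roots F x n" "coord_subspace J"] fin
        card_fixer_coord_subspace[OF J, of F]
      by (simp add: W_def)
    moreover have "card (carrier (W (card J))) > 0"
      using pos card_mono[OF _ J] by simp
    ultimately show ?thesis by simp
  qed
  have "real (card (carrier M)) = (\<Sum>J\<in>Pow {1..n}. real (card (?R (coord_subspace J))))"
    unfolding M using fin
    by (simp only: card_reflection_monoid finite_imageI finite_Pow_iff finite_atLeastAtMost of_nat_sum
        sum.reindex[OF inj_on_coord_subspace] o_def)
  also have "\<dots> = (\<Sum>J\<in>Pow {1..n}.
      real (card (carrier (W n))) * (1 / real (card (carrier (W (card J))))))"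
    using restrictions by (rule sum.cong[OF refl])
  also have "\<dots> = (\<Sum>k=0..n. real (card {J \<in> Pow {1..n}. card J = k}) *
      (real (card (carrier (W n))) * (1 / real (card (carrier (W k))))))"
    by (rule sum_fun_comp) (use card_mono[of "{1..n}"] in auto)
  also have "\<dots> = real (card (carrier (W n))) *
      (\<Sum>k=0..n. real (n choose k) * (1 / real (card (carrier (W k)))))"
    by (simp add: sum_distrib_left n_subsets Pow_def mult_ac)
  finally have "real (card (carrier M)) = \<dots>" .
  moreover have "finite (carrier M)"
    unfolding M carrier_reflection_monoid using fin by simp
  ultimately show ?thesis by (simp add: Coset.order_def)
qed

end
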